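(* Let $n$ be a positive integer. Assume that $\mathcal{A} \subset 2^{[n]}$ contains neither $Y$ nor $Y'$ as an induced subposet, and that $\varnothing \notin \mathcal{A}$ and $[n] \notin \mathcal{A}$. Then $$\sum_{A\in \mathcal{A}} \frac{1}{\binom{n}{|A|}} \le 2.$$
   Context: $[n]=\{1,\dots,n\}$ and $2^{[n]}$ is its power set. A family $\mathcal{A}\subset 2^{[n]}$ is viewed as a poset under inclusion. A poset $P$ is an induced subposet of a poset $Q$ if there is an injection $\phi:P\to Q$ such that $x\le y$ in $P$ if and only if $\phi(x)\le\phi(y)$ in $Q$. $Y$ is the poset on $4$ distinct elements $w,x,y,z$ whose order is generated by $w\le x$, $x\le y$ and $x\le z$ (so $y$ and $z$ are incomparable). $Y'$ is the poset obtained from $Y$ by reversing all relations. *)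

theory Defs
  imports Complex_Main
begin

text \<open>
  A poset is represented, as in \<^theory>\<open>HOL.Order_Relation\<close>, by its reflexive order
  relation; the underlying set is the \<^const>\<open>Field\<close> of that relation.
\<close>

definition induced_subposet :: "'a rel \<Rightarrow> 'b rel \<Rightarrow> bool" where
  "induced_subposet r s \<longleftrightarrow>
     (\<exists>\<phi>. inj_on \<phi> (Field r) \<and> \<phi> ` Field r \<subseteq> Field s \<and>
          (\<forall>x\<in>Field r. \<forall>y\<in>Field r. (x, y) \<in> r \<longleftrightarrow> (\<phi> x, \<phi> y) \<in> s))"

abbreviation inclusion_order :: "'a set set \<Rightarrow> 'a set rel" where
  "inclusion_order \<F> \<equiv> relation_of (\<subseteq>) \<F>"

datatype Y_elem = Yw | Yx | Yy | Yz

definition Y_poset :: "Y_elem rel" where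
  "Y_poset = {(Yw, Yx), (Yx, Yy), (Yx, Yz)}\<^sup>*"

definition Y'_poset :: "Y_elem rel" where
  "Y'_poset = Y_poset\<inverse>"

lemma Field_inclusion_order: "Field (inclusion_order \<F>) = \<F>"
  by (auto simp: relation_of_def Field_def)

lemma partial_order_on_inclusion_order: "partial_order_on \<F> (inclusion_order \<F>)"
  by (rule partial_order_on_relation_ofI) auto

lemma Y_poset_eq:
  "Y_poset = Id \<union> {(Yw, Yx), (Yw, Yy), (Yw, Yz), (Yx, Yy), (Yx, Yz)}" (is "_ = ?R")
proof
  show "Y_poset \<subseteq> ?R"
  proof (rule subrelI)
    fix a b assume "(a, b) \<in> Y_poset"
    then show "(a, b) \<in> ?R"
      unfolding Y_poset_def by (induction rule: rtrancl_induct) auto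
  qed
  show "?R \<subseteq> Y_poset"
    unfolding Y_poset_def
    by (auto intro: r_into_rtrancl converse_rtrancl_into_rtrancl)
qed

lemma partial_order_on_Y_poset: "partial_order_on UNIV Y_poset"
  by (auto simp: partial_order_on_def preorder_on_def refl_on_def trans_def antisym_def Y_poset_eq)

lemma partial_order_on_Y'_poset: "partial_order_on UNIV Y'_poset"
  using partial_order_on_Y_poset by (simp add: Y'_poset_def)

lemma Field_Y_poset: "Field Y_poset = UNIV" and Field_Y'_poset: "Field Y'_poset = UNIV"
  by (auto simp: Y'_poset_def Y_poset_def Field_def)

end

theory Submission
  imports Defs "HOL-Combinatorics.Multiset_Permutations"
begin

text \<open>
  By the counting behind the LYM inequality, the sum in question is the average, over all maximal
  chains of \<open>2\<^sup>S\<close> with \<open>S = {1..n}\<close>, of the number of members of the family \<open>\<F>\<close> on the chain.  A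
  maximal chain is the sequence of prefixes of an ordering \<open>xs\<close> of \<open>S\<close>, so the task is to show that
  an ordering meets \<open>\<F>\<close> at most twice on average.

  An ordering that meets \<open>\<F>\<close> in \<open>i \<ge> 2\<close> sets has excess \<open>i - 2\<close>, which is the number of sets
  \<open>B \<in> \<F>\<close> strictly between two other members of \<open>\<F>\<close> on the same chain.  An ordering that meets
  \<open>\<F>\<close> in a single set \<open>B\<close> has a deficit of one.  The excess is paid for separately at each \<open>B\<close>:
  the orderings that have \<open>B\<close> strictly between two members are mapped injectively to the orderings
  that meet \<open>\<F>\<close> in \<open>B\<close> alone (\<open>card_inner_le_card_only\<close>).

  The map reverses the ordering of \<open>B\<close> and, separately, that of \<open>S - B\<close>.  It works because the
  absence of \<open>Y\<close> and \<open>Y'\<close> makes the members above \<open>B\<close>, and likewise those below \<open>B\<close>, a chain as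
  soon as \<open>B\<close> has members on both sides.  A prefix and a suffix of the same ordering are disjoint
  or cover everything, so if they are comparable then one of them is trivial
  (\<open>comparable_prefix_suffix\<close>).  Hence an ordering of \<open>B\<close> with a prefix in the chain below \<open>B\<close>
  loses, when it is reversed, every prefix in this chain, and the same holds above \<open>B\<close>.  The trivial
  sets that could spoil this are \<open>\<emptyset>\<close> and \<open>S\<close>, which are excluded from \<open>\<F>\<close>.
\<close>

section \<open>Orderings and their chains of prefixes\<close>

definition prefix_sets :: "'a list \<Rightarrow> 'a set set" where
  "prefix_sets xs = range (\<lambda>k. set (take k xs))"

lemma prefix_sets_total:
  assumes "A \<in> prefix_sets xs" "B \<in> prefix_sets xs"
  shows "A \<subseteq> B \<or> B \<subseteq> A"
proof -
  obtain j k where "A = set (take j xs)" "B = set (take k xs)"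
    using assms by (auto simp: prefix_sets_def)
  then show ?thesis
    using set_take_subset_set_take[of j k xs] set_take_subset_set_take[of k j xs]
    by (cases "j \<le> k") auto
qed

lemma prefix_setsE:
  assumes "A \<in> prefix_sets xs"
  obtains ys zs where "xs = ys @ zs" "set ys = A"
proof -
  obtain k where "A = set (take k xs)"
    using assms by (auto simp: prefix_sets_def)
  then show ?thesis
    using that[of "take k xs" "drop k xs"] by simp
qed

lemma prefix_sets_append_left: "set ys \<in> prefix_sets (ys @ zs)"
  by (auto simp: prefix_sets_def intro!: image_eqI[where x = "length ys"])

lemma prefix_sets_appendD:
  assumes "A \<in> prefix_sets (ys @ zs)"
  shows "A \<in> prefix_sets ys \<or> (\<exists>C \<in> prefix_sets zs. A = set ys \<union> C)"
proof -
  obtain k where k: "A = set (take k ys) \<union> set (take (k - length ys) zs)"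
    using assms by (auto simp: prefix_sets_def)
  show ?thesis
  proof (cases "k \<le> length ys")
    case True
    then show ?thesis using k by (auto simp: prefix_sets_def)
  next
    case False
    then show ?thesis using k by (auto simp: prefix_sets_def)
  qed
qed

lemma prefix_sets_append_below:
  assumes "A \<in> prefix_sets (ys @ zs)" "A \<subset> set ys"
  shows "A \<in> prefix_sets ys"
  using prefix_sets_appendD[OF assms(1)] assms(2) by auto

lemma prefix_sets_append_above:
  assumes "distinct (ys @ zs)" "A \<in> prefix_sets (ys @ zs)" "set ys \<subset> A"
  shows "A - set ys \<in> prefix_sets zs"
  using prefix_sets_appendD[OF assms(2)]
proof
  assume "A \<in> prefix_sets ys"
  then have "A \<subseteq> set ys" by (auto simp: prefix_sets_def dest: in_set_takeD)
  with assms(3) show ?thesis by auto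
next
  assume "\<exists>C \<in> prefix_sets zs. A = set ys \<union> C"
  then obtain C where C: "C \<in> prefix_sets zs" "A = set ys \<union> C" by blast
  then have "C \<subseteq> set zs" by (auto simp: prefix_sets_def dest: in_set_takeD)
  with assms(1) C have "A - set ys = C" by auto
  with C show ?thesis by simp
qed

lemma prefix_sets_rev:
  assumes "distinct xs" "A \<in> prefix_sets (rev xs)"
  shows "set xs - A \<in> prefix_sets xs"
proof -
  obtain us vs where uv: "rev xs = us @ vs" "set us = A"
    using assms(2) by (rule prefix_setsE)
  then have xs: "xs = rev vs @ rev us"
    by (metis rev_append rev_rev_ident)
  with assms(1) uv have "set xs - A = set (rev vs)" by auto
  then show ?thesis using prefix_sets_append_left[of "rev vs" "rev us"] xs by simp
qed

text \<open>
  The complement of \<open>D\<close> is another prefix of \<open>xs\<close>, hence comparable to \<open>A\<close>: either \<open>A\<close> and \<open>D\<close> are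
  disjoint or they cover \<open>xs\<close>.  For nested sets this leaves only the trivial possibilities.
\<close>

lemma comparable_prefix_suffix:
  assumes "distinct xs" "A \<in> prefix_sets xs" "D \<in> prefix_sets (rev xs)"
    and "A \<subseteq> D \<or> D \<subseteq> A"
  shows "A = {} \<or> D = {} \<or> A = set xs \<or> D = set xs"
proof -
  have "A \<subseteq> set xs" "D \<subseteq> set xs"
    using assms(2,3) by (auto simp: prefix_sets_def dest: in_set_takeD)
  moreover have "A \<subseteq> set xs - D \<or> set xs - D \<subseteq> A"
    using prefix_sets_total[OF assms(2) prefix_sets_rev[OF assms(1,3)]] .
  ultimately show ?thesis using assms(4) by blast
qed

lemma card_orderings_through:
  assumes "finite S" "A \<subseteq> S"
  shows "card {xs \<in> permutations_of_set S. A \<in> prefix_sets xs} = fact (card A) * fact (card S - card A)"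
proof -
  have fin: "finite A" "finite (S - A)"
    using assms finite_subset by auto
  let ?P = "permutations_of_set A \<times> permutations_of_set (S - A)"
  have "{xs \<in> permutations_of_set S. A \<in> prefix_sets xs} = (\<lambda>(ys, zs). ys @ zs) ` ?P" (is "?L = ?R")
  proof
    show "?L \<subseteq> ?R"
    proof
      fix xs assume "xs \<in> ?L"
      then have xs: "set xs = S" "distinct xs" "A \<in> prefix_sets xs"
        by (auto simp: permutations_of_set_def)
      from xs(3) obtain ys zs where "xs = ys @ zs" "set ys = A"
        by (rule prefix_setsE)
      with xs show "xs \<in> ?R"
        by (intro image_eqI[where x = "(ys, zs)"]) (auto simp: permutations_of_set_def)
    qed
    show "?R \<subseteq> ?L"
      using assms prefix_sets_append_left by (auto simp: permutations_of_set_def)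
  qed
  moreover have "inj_on (\<lambda>(ys, zs). ys @ zs) ?P"
  proof (rule inj_onI, clarify)
    fix ys zs ys' zs'
    assume "ys @ zs = ys' @ zs'" "ys \<in> permutations_of_set A" "ys' \<in> permutations_of_set A"
    then show "ys = ys' \<and> zs = zs'"
      using length_finite_permutations_of_set[of ys A] length_finite_permutations_of_set[of ys' A]
      by simp
  qed
  ultimately show ?thesis
    using assms fin by (simp add: card_image card_cartesian_product card_Diff_subset)
qed

section \<open>Paying for the excess at a single set\<close>

definition orderings_inner :: "'a set \<Rightarrow> 'a set set \<Rightarrow> 'a set \<Rightarrow> 'a list set" where
  "orderings_inner S \<F> B =
     {xs \<in> permutations_of_set S. B \<in> prefix_sets xs \<and>
        (\<exists>A \<in> \<F> \<inter> prefix_sets xs. A \<subset> B) \<and> (\<exists>C \<in> \<F> \<inter> prefix_sets xs. B \<subset> C)}"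

definition orderings_only :: "'a set \<Rightarrow> 'a set set \<Rightarrow> 'a set \<Rightarrow> 'a list set" where
  "orderings_only S \<F> B = {xs \<in> permutations_of_set S. \<F> \<inter> prefix_sets xs = {B}}"

definition reverse_blocks :: "nat \<Rightarrow> 'a list \<Rightarrow> 'a list" where
  "reverse_blocks k xs = rev (take k xs) @ rev (drop k xs)"

lemma inj_on_reverse_blocks:
  assumes "\<And>xs. xs \<in> X \<Longrightarrow> length xs = m"
  shows "inj_on (reverse_blocks k) X"
proof (rule inj_onI)
  fix xs ys assume "xs \<in> X" "ys \<in> X" and eq: "reverse_blocks k xs = reverse_blocks k ys"
  then have "length xs = length ys" using assms by simp
  with eq have "take k xs = take k ys \<and> drop k xs = drop k ys"
    unfolding reverse_blocks_def by (subst (asm) append_eq_append_conv) auto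
  then show "xs = ys" by (metis append_take_drop_id)
qed

text \<open>
  This is where the chain condition enters: whatever member the reversed ordering might meet
  besides \<open>B\<close> would be comparable to a member, on the same side of \<open>B\<close>, met by the original
  ordering.
\<close>

lemma reverse_blocks_in_orderings_only:
  assumes "{} \<notin> \<F>" "S \<notin> \<F>" "B \<in> \<F>"
    and below: "\<And>A D. A \<in> \<F> \<Longrightarrow> D \<in> \<F> \<Longrightarrow> A \<subset> B \<Longrightarrow> D \<subset> B \<Longrightarrow> A \<subseteq> D \<or> D \<subseteq> A"
    and above: "\<And>C D. C \<in> \<F> \<Longrightarrow> D \<in> \<F> \<Longrightarrow> B \<subset> C \<Longrightarrow> B \<subset> D \<Longrightarrow> C \<subseteq> D \<or> D \<subseteq> C"
    and "xs \<in> orderings_inner S \<F> B"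
  shows "reverse_blocks (card B) xs \<in> orderings_only S \<F> B"
proof -
  from assms(6) have xs: "set xs = S" "distinct xs" "B \<in> prefix_sets xs"
    by (auto simp: orderings_inner_def permutations_of_set_def)
  from assms(6) obtain A C where A: "A \<in> \<F>" "A \<in> prefix_sets xs" "A \<subset> B"
    and C: "C \<in> \<F>" "C \<in> prefix_sets xs" "B \<subset> C"
    by (auto simp: orderings_inner_def)
  from xs(3) obtain ys zs where yz: "xs = ys @ zs" "set ys = B"
    by (rule prefix_setsE)
  with xs have dist: "distinct ys" "distinct zs" "set ys \<inter> set zs = {}" "card B = length ys"
    using distinct_card[of ys] by auto
  have rev: "reverse_blocks (card B) xs = rev ys @ rev zs"
    using yz dist by (simp add: reverse_blocks_def)
  have Alow: "A \<in> prefix_sets ys"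
    using prefix_sets_append_below A yz xs by blast
  have Chigh: "C - B \<in> prefix_sets zs"
    using prefix_sets_append_above C yz xs by blast
  have B: "B \<in> prefix_sets (rev ys @ rev zs)"
    using prefix_sets_append_left[of "rev ys" "rev zs"] yz by simp
  have dist': "distinct (rev ys @ rev zs)" using dist by simp
  have "D = B" if D: "D \<in> \<F>" "D \<in> prefix_sets (rev ys @ rev zs)" for D
  proof (rule ccontr)
    assume "D \<noteq> B"
    then consider "D \<subset> B" | "B \<subset> D"
      using prefix_sets_total[OF D(2) B] by blast
    then show False
    proof cases
      case 1
      have Dlow: "D \<in> prefix_sets (rev ys)"
        using 1 prefix_sets_append_below[OF D(2)] yz by simp
      have "A = {} \<or> D = {} \<or> A = B \<or> D = B"
        using comparable_prefix_suffix[OF dist(1) Alow Dlow below[OF A(1) D(1) A(3) 1]] yz(2) by simp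
      then show False using assms(1) A(1,3) D(1) 1 by auto
    next
      case 2
      then have "D - B \<in> prefix_sets (rev zs)"
        using prefix_sets_append_above[OF dist' D(2)] yz by simp
      moreover have "C - B \<subseteq> D - B \<or> D - B \<subseteq> C - B"
        using above[OF C(1) D(1) C(3) 2] by blast
      ultimately have "C - B = {} \<or> D - B = {} \<or> C - B = set zs \<or> D - B = set zs"
        using comparable_prefix_suffix[OF dist(2) Chigh] by blast
      moreover have "S = B \<union> set zs" using xs yz by auto
      ultimately have "C = S \<or> D = S" using C(3) 2 by blast
      then show False using assms(2) C D by blast
    qed
  qed
  with B assms(3) have "\<F> \<inter> prefix_sets (rev ys @ rev zs) = {B}" by blast
  moreover have "rev ys @ rev zs \<in> permutations_of_set S"
    using xs yz dist by (auto simp: permutations_of_set_def)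
  ultimately show ?thesis by (simp add: orderings_only_def rev)
qed

text \<open>
  The two chain conditions are the absence of \<open>Y'\<close> and of \<open>Y\<close>, which say something about \<open>B\<close> only
  if \<open>B\<close> lies strictly between two members.  If it does not, there is no excess at \<open>B\<close>.
\<close>

lemma card_inner_le_card_only:
  assumes "{} \<notin> \<F>" "S \<notin> \<F>" "B \<in> \<F>"
    and below: "\<And>A B C D. {A, B, C, D} \<subseteq> \<F> \<Longrightarrow> B \<subset> C \<Longrightarrow> A \<subset> B \<Longrightarrow> D \<subset> B \<Longrightarrow> A \<subseteq> D \<or> D \<subseteq> A"
    and above: "\<And>A B C D. {A, B, C, D} \<subseteq> \<F> \<Longrightarrow> A \<subset> B \<Longrightarrow> B \<subset> C \<Longrightarrow> B \<subset> D \<Longrightarrow> C \<subseteq> D \<or> D \<subseteq> C"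
  shows "card (orderings_inner S \<F> B) \<le> card (orderings_only S \<F> B)"
proof (cases "orderings_inner S \<F> B = {}")
  case False
  then obtain A0 C0 where AC: "A0 \<in> \<F>" "C0 \<in> \<F>" "A0 \<subset> B" "B \<subset> C0"
    by (auto simp: orderings_inner_def)
  show ?thesis
  proof (rule card_inj_on_le)
    show "inj_on (reverse_blocks (card B)) (orderings_inner S \<F> B)"
      by (rule inj_on_reverse_blocks[where m = "card S"])
        (auto simp: orderings_inner_def permutations_of_set_def distinct_card)
    have "A \<subseteq> D \<or> D \<subseteq> A" if "A \<in> \<F>" "D \<in> \<F>" "A \<subset> B" "D \<subset> B" for A D
      using below[of A B C0 D] that AC assms(3) by simp
    moreover have "C \<subseteq> D \<or> D \<subseteq> C" if "C \<in> \<F>" "D \<in> \<F>" "B \<subset> C" "B \<subset> D" for C D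
      using above[of A0 B C D] that AC assms(3) by simp
    ultimately have "reverse_blocks (card B) xs \<in> orderings_only S \<F> B"
      if "xs \<in> orderings_inner S \<F> B" for xs
      by (rule reverse_blocks_in_orderings_only[OF assms(1-3) _ _ that])
    then show "reverse_blocks (card B) ` orderings_inner S \<F> B \<subseteq> orderings_only S \<F> B"
      by (rule image_subsetI)
    show "finite (orderings_only S \<F> B)"
      by (simp add: orderings_only_def)
  qed
qed simp

section \<open>Averaging over all orderings\<close>

text \<open>
  Removing the least and the greatest member from the chain that an ordering cuts out of \<open>\<F>\<close>
  leaves the inner ones.  When there is only one member, it is both least and greatest, and this
  frees one unit for the term that counts the lone member.
\<close>

lemma card_met_plus_only_le:
  assumes "finite \<F>" "xs \<in> permutations_of_set S"
  shows "card {B \<in> \<F>. B \<in> prefix_sets xs} + card {B \<in> \<F>. xs \<in> orderings_only S \<F> B}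
       \<le> 2 + card {B \<in> \<F>. xs \<in> orderings_inner S \<F> B}"
proof -
  define K where "K = \<F> \<inter> prefix_sets xs"
  have K: "{B \<in> \<F>. B \<in> prefix_sets xs} = K" "finite K" using assms by (auto simp: K_def)
  have only: "{B \<in> \<F>. xs \<in> orderings_only S \<F> B} = {B. K = {B}}"
    using assms(2) by (auto simp: orderings_only_def K_def)
  consider "K = {}" | B where "K = {B}" | "K \<noteq> {}" "{B. K = {B}} = {}" by blast
  then show ?thesis
  proof cases
    case 3
    have tot: "A \<subseteq> B \<or> B \<subseteq> A" if "A \<in> K" "B \<in> K" for A B
      using that prefix_sets_total by (auto simp: K_def)
    obtain m where "m \<in> K" "\<forall>B \<in> K. B \<subseteq> m \<longrightarrow> m = B"
      using finite_has_minimal[OF K(2) 3(1)] by metis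
    then have m: "m \<in> K" "\<And>B. B \<in> K \<Longrightarrow> m \<subseteq> B"
      using tot by auto
    obtain M where "M \<in> K" "\<forall>B \<in> K. M \<subseteq> B \<longrightarrow> M = B"
      using finite_has_maximal[OF K(2) 3(1)] by metis
    then have M: "M \<in> K" "\<And>B. B \<in> K \<Longrightarrow> B \<subseteq> M"
      using tot by auto
    have sub: "K - {m, M} \<subseteq> {B \<in> \<F>. xs \<in> orderings_inner S \<F> B}"
    proof
      fix B assume "B \<in> K - {m, M}"
      then have B: "B \<in> K" "m \<subset> B" "B \<subset> M" using m(2) M(2) by blast+
      then show "B \<in> {B \<in> \<F>. xs \<in> orderings_inner S \<F> B}"
        using m(1) M(1) assms(2) unfolding K_def orderings_inner_def by blast
    qed
    have "card K - card {m, M} \<le> card (K - {m, M})"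
      by (rule diff_card_le_card_Diff) simp
    also have "\<dots> \<le> card {B \<in> \<F>. xs \<in> orderings_inner S \<F> B}"
      by (rule card_mono[OF _ sub]) (use assms(1) in simp)
    finally have "card K \<le> 2 + card {B \<in> \<F>. xs \<in> orderings_inner S \<F> B}"
      using card_insert_le_m1[of 2 "{M}" m] by simp
    then show ?thesis unfolding K only 3(2) by simp
  qed (unfold K only, auto)
qed

lemma sum_card_swap:
  assumes "finite X" "finite \<F>"
  shows "(\<Sum>x\<in>X. card {B \<in> \<F>. R x B}) = (\<Sum>B\<in>\<F>. card {x \<in> X. R x B})"
  by (rule sum_multicount_gen) (simp_all add: assms)

lemma sum_inverse_binomial_le_2:
  assumes "finite S" "\<F> \<subseteq> Pow S" "{} \<notin> \<F>" "S \<notin> \<F>"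
    and below: "\<And>A B C D. {A, B, C, D} \<subseteq> \<F> \<Longrightarrow> B \<subset> C \<Longrightarrow> A \<subset> B \<Longrightarrow> D \<subset> B \<Longrightarrow> A \<subseteq> D \<or> D \<subseteq> A"
    and above: "\<And>A B C D. {A, B, C, D} \<subseteq> \<F> \<Longrightarrow> A \<subset> B \<Longrightarrow> B \<subset> C \<Longrightarrow> B \<subset> D \<Longrightarrow> C \<subseteq> D \<or> D \<subseteq> C"
  shows "(\<Sum>A\<in>\<F>. 1 / real (card S choose card A)) \<le> 2"
proof -
  let ?P = "permutations_of_set S"
  have fin: "finite \<F>" using assms(1,2) finite_subset by auto
  have "(\<Sum>xs\<in>?P. card {B \<in> \<F>. B \<in> prefix_sets xs}) +
        (\<Sum>xs\<in>?P. card {B \<in> \<F>. xs \<in> orderings_only S \<F> B})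
      \<le> (\<Sum>xs\<in>?P. 2 + card {B \<in> \<F>. xs \<in> orderings_inner S \<F> B})"
    unfolding sum.distrib[symmetric] by (rule sum_mono) (rule card_met_plus_only_le[OF fin])
  moreover have "(\<Sum>xs\<in>?P. card {B \<in> \<F>. xs \<in> orderings_inner S \<F> B})
      \<le> (\<Sum>xs\<in>?P. card {B \<in> \<F>. xs \<in> orderings_only S \<F> B})"
  proof -
    have "{xs \<in> ?P. xs \<in> orderings_inner S \<F> B} = orderings_inner S \<F> B"
      and "{xs \<in> ?P. xs \<in> orderings_only S \<F> B} = orderings_only S \<F> B" for B
      by (auto simp: orderings_inner_def orderings_only_def)
    moreover have "card (orderings_inner S \<F> B) \<le> card (orderings_only S \<F> B)" if "B \<in> \<F>" for B
      by (rule card_inner_le_card_only[OF assms(3,4) that]) (erule (3) below, erule (3) above)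
    ultimately show ?thesis
      by (simp add: sum_card_swap fin sum_mono)
  qed
  ultimately have "(\<Sum>xs\<in>?P. card {B \<in> \<F>. B \<in> prefix_sets xs}) \<le> 2 * fact (card S)"
    using assms(1) unfolding sum.distrib by simp
  also have "(\<Sum>xs\<in>?P. card {B \<in> \<F>. B \<in> prefix_sets xs})
      = (\<Sum>A\<in>\<F>. card {xs \<in> ?P. A \<in> prefix_sets xs})"
    by (rule sum_card_swap) (simp_all add: fin)
  also have "\<dots> = (\<Sum>A\<in>\<F>. fact (card A) * fact (card S - card A))"
    by (rule sum.cong[OF refl], rule card_orderings_through) (use assms(1,2) in auto)
  finally have "real (\<Sum>A\<in>\<F>. fact (card A) * fact (card S - card A)) \<le> real (2 * fact (card S))"
    by (rule of_nat_mono)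
  then have "(\<Sum>A\<in>\<F>. fact (card A) * fact (card S - card A)) / fact (card S) \<le> (2 :: real)"
    by (simp add: divide_le_eq)
  also have "(\<Sum>A\<in>\<F>. fact (card A) * fact (card S - card A)) / fact (card S)
      = (\<Sum>A\<in>\<F>. 1 / real (card S choose card A))"
    unfolding sum_divide_distrib
  proof (rule sum.cong)
    fix A assume "A \<in> \<F>"
    then have "card A \<le> card S" using assms(1,2) by (auto intro: card_mono)
    then show "fact (card A) * fact (card S - card A) / fact (card S) = 1 / real (card S choose card A)"
      by (simp add: binomial_fact)
  qed simp
  finally show ?thesis .
qed

section \<open>Forbidden induced subposets\<close>

lemma induced_Y_posetI:
  assumes "{A, B, C, D} \<subseteq> \<F>" "A \<subset> B" "B \<subset> C" "B \<subset> D" "\<not> C \<subseteq> D" "\<not> D \<subseteq> C"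
  shows "induced_subposet Y_poset (inclusion_order \<F>)"
  unfolding induced_subposet_def
proof (intro exI[of _ "case_Y_elem A B C D"] conjI ballI)
  show "inj_on (case_Y_elem A B C D) (Field Y_poset)"
    by (rule inj_onI) (use assms in \<open>auto split: Y_elem.splits\<close>)
  show "case_Y_elem A B C D ` Field Y_poset \<subseteq> Field (inclusion_order \<F>)"
    using assms(1) by (auto simp: Field_inclusion_order split: Y_elem.splits)
  show "(x, y) \<in> Y_poset \<longleftrightarrow> (case_Y_elem A B C D x, case_Y_elem A B C D y) \<in> inclusion_order \<F>"
    for x y
    using assms by (cases x; cases y) (auto simp: Y_poset_eq relation_of_def)
qed

lemma induced_Y'_posetI:
  assumes "{A, B, C, D} \<subseteq> \<F>" "B \<subset> A" "C \<subset> B" "D \<subset> B" "\<not> C \<subseteq> D" "\<not> D \<subseteq> C"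
  shows "induced_subposet Y'_poset (inclusion_order \<F>)"
  unfolding induced_subposet_def
proof (intro exI[of _ "case_Y_elem A B C D"] conjI ballI)
  show "inj_on (case_Y_elem A B C D) (Field Y'_poset)"
    by (rule inj_onI) (use assms in \<open>auto split: Y_elem.splits\<close>)
  show "case_Y_elem A B C D ` Field Y'_poset \<subseteq> Field (inclusion_order \<F>)"
    using assms(1) by (auto simp: Field_inclusion_order split: Y_elem.splits)
  show "(x, y) \<in> Y'_poset \<longleftrightarrow> (case_Y_elem A B C D x, case_Y_elem A B C D y) \<in> inclusion_order \<F>"
    for x y
    using assms by (cases x; cases y) (auto simp: Y'_poset_def Y_poset_eq relation_of_def)
qed

theorem theorem7:
  fixes n :: nat and \<A> :: "nat set set"
  assumes "n > 0"
    and "\<A> \<subseteq> Pow {1..n}"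
    and "\<not> induced_subposet Y_poset (inclusion_order \<A>)"
    and "\<not> induced_subposet Y'_poset (inclusion_order \<A>)"
    and "{} \<notin> \<A>" and "{1..n} \<notin> \<A>"
  shows "(\<Sum>A\<in>\<A>. 1 / real (n choose card A)) \<le> 2"
proof -
  have "A \<subseteq> D \<or> D \<subseteq> A" if "{A, B, C, D} \<subseteq> \<A>" "B \<subset> C" "A \<subset> B" "D \<subset> B" for A B C D
    using induced_Y'_posetI[of C B A D \<A>] that assms(4) by blast
  moreover have "C \<subseteq> D \<or> D \<subseteq> C" if "{A, B, C, D} \<subseteq> \<A>" "A \<subset> B" "B \<subset> C" "B \<subset> D" for A B C D
    using induced_Y_posetI[of A B C D \<A>] that assms(3) by blast
  ultimately have "(\<Sum>A\<in>\<A>. 1 / real (card {1..n} choose card A)) \<le> 2"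
    using sum_inverse_binomial_le_2[of "{1..n}" \<A>] assms(2,5,6) by blast
  then show ?thesis by simp
qed

end
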